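(* Let $p>2$ be a prime, $n\ge31$ an integer, and let $M_1,\dots,M_n$ be symmetric $n\times n$ matrices over $\mathbb{F}_p$ such that every nonzero $\mathbb{F}_p$-linear combination of them has rank $n$. Let $Q_i(x)=x^TM_ix$ and $\mathrm{QGS}(p,n)=\{x\in\mathbb{F}_p^n : \exists i \text{ with } Q_1(x)=\dots=Q_{i-1}(x)=0,\ Q_i(x)=1\}$. Then the $\mathrm{VC}_2$-dimension of $\mathrm{QGS}(p,n)$ is at least $3$.
   Context: For a finite abelian group $G$ and $A\subseteq G$, $A$ has $\mathrm{VC}_2$-dimension at least $k$ ($k\ge1$) if there exist elements $\{x_i: i\in[k]\}\cup\{y_i : i\in[k]\}\cup\{z_S : S\subseteq[k]^2\}$ of $G$ such that $x_i+y_j+z_S\in A$ if and only if $(i,j)\in S$; the $\mathrm{VC}_2$-dimension of $A$ is the largest such $k$. The matrices $M_1,\dots,M_n$ (the paper describes them as a basis of a space of symmetric matrices all of whose nonzero members have rank $n$; such exist for odd $n$) define the quadratic Green–Sanders example $\mathrm{QGS}(p,n)$. *)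

theory Defs
  imports
    "HOL-Analysis.Cartesian_Space"
    "Berlekamp_Zassenhaus.Finite_Field"
begin

definition vc2_dim_at_least :: "'a::{finite,ab_group_add} set \<Rightarrow> nat \<Rightarrow> bool" where
  "vc2_dim_at_least A k \<longleftrightarrow>
     (\<exists>(x :: nat \<Rightarrow> 'a) (y :: nat \<Rightarrow> 'a) (z :: (nat \<times> nat) set \<Rightarrow> 'a).
        \<forall>S \<subseteq> {1..k} \<times> {1..k}. \<forall>i\<in>{1..k}. \<forall>j\<in>{1..k}.
          x i + y j + z S \<in> A \<longleftrightarrow> (i, j) \<in> S)"

text \<open>
  The condition holds trivially for \<open>k = 0\<close>, so a set without any \<open>k \<ge> 1\<close> as above
  (such as the empty set) gets dimension 0. The maximum is over a finite set, see below.
\<close>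

definition vc2_dim :: "'a::{finite,ab_group_add} set \<Rightarrow> nat" where
  "vc2_dim A = Max {k. vc2_dim_at_least A k}"

lemma vc2_dim_at_least_le_card:
  fixes A :: "'a::{finite,ab_group_add} set"
  assumes "vc2_dim_at_least A k"
  shows "k \<le> CARD('a)"
proof -
  obtain x y :: "nat \<Rightarrow> 'a" and z where xyz:
    "\<forall>S \<subseteq> {1..k} \<times> {1..k}. \<forall>i\<in>{1..k}. \<forall>j\<in>{1..k}. x i + y j + z S \<in> A \<longleftrightarrow> (i, j) \<in> S"
    using assms unfolding vc2_dim_at_least_def by blast
  have "inj_on z (Pow ({1..k} \<times> {1..k}))"
  proof (rule inj_onI)
    fix S T assume S: "S \<in> Pow ({1..k} \<times> {1..k})" and T: "T \<in> Pow ({1..k} \<times> {1..k})"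
      and eq: "z S = z T"
    have "(i, j) \<in> S \<longleftrightarrow> (i, j) \<in> T" if "i \<in> {1..k}" "j \<in> {1..k}" for i j
    proof -
      have "x i + y j + z S \<in> A \<longleftrightarrow> (i, j) \<in> S" "x i + y j + z T \<in> A \<longleftrightarrow> (i, j) \<in> T"
        using xyz[rule_format, OF _ that] S T by blast+
      then show ?thesis using eq by simp
    qed
    then show "S = T" using S T by auto
  qed
  then have "card (Pow ({1..k} \<times> {1..k})) \<le> CARD('a)"
    by (rule card_inj_on_le) auto
  then have "2 ^ (k * k) \<le> CARD('a)"
    by (simp add: card_Pow card_cartesian_product)
  moreover have "k * k < 2 ^ (k * k)" by simp
  moreover have "k \<le> k * k" by simp
  ultimately show ?thesis by linarith
qed

lemma vc2_dim_at_least_mono: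
  assumes "vc2_dim_at_least A l" "k \<le> l"
  shows "vc2_dim_at_least A k"
proof -
  obtain x y z where xyz:
    "\<forall>S \<subseteq> {1..l} \<times> {1..l}. \<forall>i\<in>{1..l}. \<forall>j\<in>{1..l}. x i + y j + z S \<in> A \<longleftrightarrow> (i, j) \<in> S"
    using assms(1) unfolding vc2_dim_at_least_def by blast
  have "x i + y j + z S \<in> A \<longleftrightarrow> (i, j) \<in> S"
    if "S \<subseteq> {1..k} \<times> {1..k}" "i \<in> {1..k}" "j \<in> {1..k}" for S i j
  proof (rule xyz[rule_format])
    show "S \<subseteq> {1..l} \<times> {1..l}"
      by (rule subset_trans[OF that(1)]) (use assms(2) in \<open>intro Sigma_mono, auto\<close>)
  qed (use that assms(2) in auto)
  then show ?thesis
    unfolding vc2_dim_at_least_def by blast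
qed

lemma finite_vc2_dim_at_least:
  fixes A :: "'a::{finite,ab_group_add} set"
  shows "finite {k. vc2_dim_at_least A k}"
  by (rule finite_subset[of _ "{..CARD('a)}"]) (auto dest: vc2_dim_at_least_le_card)

lemma le_vc2_dim_iff: "k \<le> vc2_dim A \<longleftrightarrow> vc2_dim_at_least A k"
proof -
  have "vc2_dim_at_least A 0" by (simp add: vc2_dim_at_least_def)
  then have "vc2_dim_at_least A (vc2_dim A)"
    using Max_in[OF finite_vc2_dim_at_least[of A]] unfolding vc2_dim_def by blast
  then show ?thesis
    using vc2_dim_at_least_mono Max_ge[OF finite_vc2_dim_at_least[of A]]
    unfolding vc2_dim_def by blast
qed

definition quad_form :: "'a::comm_ring_1 ^ 'n ^ 'n \<Rightarrow> 'a ^ 'n \<Rightarrow> 'a" where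
  "quad_form M x = (\<Sum>a\<in>UNIV. x $ a * (M *v x) $ a)"

definition matrix_lincomb :: "(nat \<Rightarrow> 'a::comm_ring_1) \<Rightarrow> (nat \<Rightarrow> 'a ^ 'n ^ 'n) \<Rightarrow> 'a ^ 'n ^ 'n" where
  "matrix_lincomb c M = (\<chi> a b. \<Sum>i=1..CARD('n). c i * M i $ a $ b)"

text \<open>
  The type \<open>'p mod_ring\<close> with \<open>'p :: prime_card\<close> is the field of integers modulo the prime
  \<open>CARD('p)\<close>, and the dimension is \<open>CARD('n)\<close>. The matrices are numbered from 1, and only
  \<open>M 1, \<dots>, M CARD('n)\<close> matter.
\<close>

definition QGS :: "(nat \<Rightarrow> 'p::prime_card mod_ring ^ 'n ^ 'n) \<Rightarrow> ('p mod_ring ^ 'n) set" where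
  "QGS M = {x. \<exists>i\<in>{1..CARD('n)}.
     (\<forall>j\<in>{1..<i}. quad_form (M j) x = 0) \<and> quad_form (M i) x = 1}"

end

theory Submission
  imports Defs
begin

text \<open>
  Only the forms \<open>Q\<^sub>1\<close> and \<open>Q\<^sub>2\<close> are needed. Choose vectors \<open>x i\<close>, \<open>y j\<close> with prescribed products
  \<open>B\<^sub>k (x i, y j)\<close>, together with two vectors spanning a common isotropic subspace of \<open>Q\<^sub>1\<close> and \<open>Q\<^sub>2\<close>, such that
  the images of all eight vectors under \<open>M\<^sub>1\<close> and \<open>M\<^sub>2\<close> are linearly independent; counting shows that this is
  possible for \<open>n \<ge> 31\<close>. Then \<open>z\<close> can be found with arbitrary \<open>B\<^sub>k (x i, z)\<close> and \<open>B\<^sub>k (y j, z)\<close>, and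
  the isotropic vectors allow to correct \<open>Q\<^sub>k z\<close> to \<open>0\<close>. So the values \<open>Q\<^sub>k (x i + y j + z)\<close> are
  \<open>\<alpha>\<^sub>k i + \<beta>\<^sub>k j + m\<^sub>k i j\<close> with a fixed \<open>m\<close> and arbitrary \<open>\<alpha>\<close>, \<open>\<beta>\<close>, and it remains to realize
  all 512 patterns on the 3 by 3 grid: choose \<open>\<alpha>\<^sub>1\<close>, \<open>\<beta>\<^sub>1\<close> such that \<open>Q\<^sub>1\<close> decides some cells correctly and
  vanishes on the cells of a forest, where \<open>Q\<^sub>2\<close> can then take any values. The residues behave
  differently for \<open>p = 3\<close> and \<open>p \<ge> 5\<close>, hence two tables.
\<close>

subsection \<open>Linear systems and isotropic vectors over a finite field\<close>

definition dot :: "'a::comm_ring_1 ^ 'n \<Rightarrow> 'a ^ 'n \<Rightarrow> 'a" where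
  "dot x y = (\<Sum>a\<in>UNIV. x $ a * y $ a)"

lemma dot_commute: "dot x y = dot y x"
  by (simp add: dot_def mult.commute)

lemma dot_add_right: "dot x (y + z) = dot x y + dot x z"
  by (simp add: dot_def distrib_left sum.distrib)

lemma dot_scale_right: "dot x (c *s y) = c * dot x y"
  by (simp add: dot_def sum_distrib_left mult.left_commute)

lemma dot_zero_right: "dot x 0 = 0"
  by (simp add: dot_def)

lemma dot_diff_right: "dot x (y - z) = dot x y - dot x z"
  by (simp add: dot_def right_diff_distrib sum_subtractf)

lemma dot_sum_right: "dot x (sum f I) = (\<Sum>i\<in>I. dot x (f i))"
  by (induction I rule: infinite_finite_induct) (simp_all add: dot_add_right dot_zero_right)

lemmas dot_right = dot_add_right dot_scale_right dot_zero_right dot_diff_right dot_sum_right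
lemma dot_left:
  "dot (y + z) x = dot y x + dot z x" "dot (c *s y) x = c * dot y x" "dot 0 x = 0"
  "dot (y - z) x = dot y x - dot z x" "dot (sum f I) x = (\<Sum>i\<in>I. dot (f i) x)"
  by (simp_all add: dot_commute[of _ x] dot_right)

lemma dot_axis: "dot x (axis a 1) = x $ a"
  by (simp add: dot_def axis_def if_distrib cong: if_cong)

lemma dot_matrix_vector: "dot x (A *v y) = dot (transpose A *v x) y"
  by (simp add: dot_def matrix_vector_mult_def transpose_def sum_distrib_left sum_distrib_right)
     (subst sum.swap, simp add: mult_ac)

lemma quad_form_dot: "quad_form A x = dot x (A *v x)"
  by (simp add: quad_form_def dot_def)

text \<open>The induction hypothesis, applied to unit targets, yields vectors \<open>e\<close> dual
  to the old functionals. With their help a vector is built on which the old functionals vanish and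
  the new one is 1; adding a multiple of it corrects the last equation.\<close>

lemma dual_system_solvable:
  fixes g :: "'i \<Rightarrow> 'a::field ^ 'n"
  assumes "finite I" "\<And>c. (\<Sum>i\<in>I. c i *s g i) = 0 \<Longrightarrow> \<forall>i\<in>I. c i = 0"
  shows "\<exists>x. \<forall>i\<in>I. dot (g i) x = t i"
  using assms
proof (induction I arbitrary: t rule: finite_induct)
  case empty
  then show ?case by simp
next
  case (insert j I)
  have indep: "\<forall>i\<in>I. c i = 0" if "(\<Sum>i\<in>I. c i *s g i) = 0" for c
  proof -
    have "(\<Sum>i\<in>insert j I. (c(j := 0)) i *s g i) = (\<Sum>i\<in>I. c i *s g i)"
      using insert.hyps by (auto intro!: sum.cong)
    then have "\<forall>i\<in>insert j I. (c(j := 0)) i = 0"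
      using that insert.prems by metis
    then show ?thesis using insert.hyps(2) by (metis fun_upd_other insertI2)
  qed
  have IH: "\<exists>x. \<forall>i\<in>I. dot (g i) x = t i" for t
    by (rule insert.IH) (rule indep)
  have "\<forall>l. \<exists>x. \<forall>i\<in>I. dot (g i) x = (if i = l then 1 else 0)"
    by (intro allI IH)
  then obtain e where e: "\<And>l i. i \<in> I \<Longrightarrow> dot (g i) (e l) = (if i = l then 1 else 0)"
    by metis
  define h where "h = g j - (\<Sum>i\<in>I. dot (g j) (e i) *s g i)"
  have "h \<noteq> 0"
  proof
    assume "h = 0"
    define c where "c = (\<lambda>i. - dot (g j) (e i))(j := 1)"
    have "(\<Sum>i\<in>insert j I. c i *s g i) = g j + (\<Sum>i\<in>I. - (dot (g j) (e i) *s g i))"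
      using insert.hyps unfolding c_def
      by (auto intro!: sum.cong arg_cong2[of _ _ _ _ "(+)"] simp: vec_eq_iff)
    also have "\<dots> = 0" using \<open>h = 0\<close> by (simp add: h_def sum_negf)
    finally have "c j = 0" using insert.prems by blast
    then show False by (simp add: c_def)
  qed
  then obtain a where "h $ a \<noteq> 0" by (auto simp: vec_eq_iff)
  define y where "y = inverse (h $ a) *s axis a 1"
  have hy: "dot h y = 1" using \<open>h $ a \<noteq> 0\<close> by (simp add: y_def dot_right dot_axis)
  define y' where "y' = y - (\<Sum>i\<in>I. dot (g i) y *s e i)"
  have y'I: "dot (g i) y' = 0" if "i \<in> I" for i
    using that insert.hyps by (simp add: y'_def dot_right e if_distrib[of "(*) _"] cong: if_cong)
  have y'j: "dot (g j) y' = 1"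
    using hy by (simp add: y'_def h_def dot_right dot_left mult.commute)
  obtain x0 where x0: "\<forall>i\<in>I. dot (g i) x0 = t i"
    using IH by blast
  have "\<forall>i\<in>insert j I. dot (g i) (x0 + (t j - dot (g j) x0) *s y') = t i"
    using x0 y'I y'j by (auto simp: dot_right)
  then show ?case by blast
qed

section \<open>Counting arguments over a finite field\<close>

lemma card_le_kernel:
  fixes S :: "('a::{field,finite} ^ 'n) set"
  assumes "finite I" "\<And>x y. x \<in> S \<Longrightarrow> y \<in> S \<Longrightarrow> x - y \<in> S"
  shows "card S \<le> card {x\<in>S. \<forall>i\<in>I. dot (g i) x = 0} * CARD('a) ^ card I"
proof -
  let ?K = "{x\<in>S. \<forall>i\<in>I. dot (g i) x = 0}"
  define F where "F f = {x\<in>S. \<forall>i\<in>I. dot (g i) x = f i}" for f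
  have "S \<subseteq> (\<Union>f\<in>I \<rightarrow>\<^sub>E UNIV. F f)"
  proof
    fix x assume "x \<in> S"
    then have "x \<in> F (restrict (\<lambda>i. dot (g i) x) I)" by (simp add: F_def)
    moreover have "restrict (\<lambda>i. dot (g i) x) I \<in> I \<rightarrow>\<^sub>E UNIV" by simp
    ultimately show "x \<in> (\<Union>f\<in>I \<rightarrow>\<^sub>E UNIV. F f)" by (rule UN_I[rotated])
  qed
  then have "card S \<le> card (\<Union>f\<in>I \<rightarrow>\<^sub>E UNIV. F f)" by (rule card_mono[OF finite])
  also have "\<dots> \<le> (\<Sum>f\<in>I \<rightarrow>\<^sub>E UNIV. card (F f))"
    by (rule card_UN_le) (simp add: finite_PiE assms(1))
  also have "\<dots> \<le> (\<Sum>f\<in>I \<rightarrow>\<^sub>E (UNIV :: 'a set). card ?K)"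
  proof (rule sum_mono)
    fix f
    show "card (F f) \<le> card ?K"
    \<comment> \<open>A nonempty fibre, translated by minus one of its points, lands in the
      kernel.\<close>
    proof (cases "F f = {}")
      case False
      then obtain x where x: "x \<in> F f" by blast
      have "(\<lambda>y. y - x) ` F f \<subseteq> ?K"
        using x assms(2) by (auto simp: F_def dot_right)
      then show ?thesis by (intro card_inj_on_le[of "\<lambda>y. y - x"]) (simp_all add: inj_on_def)
    qed simp
  qed
  also have "\<dots> = card ?K * CARD('a) ^ card I"
    using assms(1) by (simp add: card_PiE)
  finally show ?thesis .
qed

lemma card_le_affine:
  fixes g :: "'i \<Rightarrow> 'a::{field,finite} ^ 'n"
  assumes "finite I" "\<forall>i\<in>I. dot (g i) x0 = t i"
  shows "CARD('a) ^ CARD('n) \<le> card {x. \<forall>i\<in>I. dot (g i) x = t i} * CARD('a) ^ card I"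
proof -
  let ?K = "{x \<in> UNIV. \<forall>i\<in>I. dot (g i) x = 0}"
  have "(\<lambda>x. x + x0) ` ?K \<subseteq> {x. \<forall>i\<in>I. dot (g i) x = t i}"
    by (rule image_subsetI) (simp add: dot_add_right assms(2))
  then have "card ?K \<le> card {x. \<forall>i\<in>I. dot (g i) x = t i}"
    by (rule card_inj_on_le[rotated]) (simp_all add: inj_on_def)
  moreover have "CARD('a ^ 'n) \<le> card ?K * CARD('a) ^ card I"
    by (rule card_le_kernel[OF assms(1)]) simp
  ultimately show ?thesis
    unfolding CARD_vec by (rule order_trans[OF _ mult_le_mono1, rotated])
qed

text \<open>Pigeonhole: squares fill more than half of the field, so the values
  \<open>a * s\<^sup>2\<close> and the values \<open>d - b * t\<^sup>2\<close> overlap.\<close>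

lemma binary_form_universal:
  fixes a b d :: "'a::{field,finite}"
  assumes "a \<noteq> 0" "b \<noteq> 0"
  shows "\<exists>s t. a * s\<^sup>2 + b * t\<^sup>2 = d"
proof -
  define R where "R = range (\<lambda>s::'a. s\<^sup>2)"
  have fib: "card {s. s\<^sup>2 = r} \<le> 2" if r: "r \<in> R" for r :: 'a
  proof -
    obtain s0 where "r = s0\<^sup>2" using r by (auto simp: R_def)
    then have "{s. s\<^sup>2 = r} \<subseteq> {s0, - s0}" by (auto simp: power2_eq_iff)
    then have "card {s. s\<^sup>2 = r} \<le> card {s0, - s0}" by (intro card_mono) auto
    also have "\<dots> \<le> 2" by (simp add: card_insert_if)
    finally show ?thesis .
  qed
  have "0 \<in> R" unfolding R_def by (rule image_eqI[of _ _ 0]) auto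
  have "UNIV = (\<Union>r\<in>R. {s. s\<^sup>2 = r})" by (auto simp: R_def)
  then have "CARD('a) \<le> (\<Sum>r\<in>R. card {s. s\<^sup>2 = r})"
    using card_UN_le[of R "\<lambda>r. {s. s\<^sup>2 = r}"] by simp
  \<comment> \<open>Zero has a single square root, which makes the final bound strict.\<close>
  also have "\<dots> = card {s::'a. s\<^sup>2 = 0} + (\<Sum>r\<in>R - {0}. card {s. s\<^sup>2 = r})"
    using \<open>0 \<in> R\<close> by (simp add: sum.remove)
  also have "\<dots> \<le> 1 + (\<Sum>r\<in>R - {0}. 2)"
    by (intro add_mono sum_mono fib) auto
  also have "\<dots> < 2 * card R"
  proof -
    have "card R > 0" using \<open>0 \<in> R\<close> by (auto simp: card_gt_0_iff)
    then show ?thesis using \<open>0 \<in> R\<close> by (simp add: card_Diff_singleton)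
  qed
  finally have R: "CARD('a) < 2 * card R" .
  have "card ((\<lambda>r. a * r) ` R) = card R"
    by (rule card_image) (simp add: inj_on_def assms(1))
  moreover have "card ((\<lambda>r. d - b * r) ` R) = card R"
    by (rule card_image) (simp add: inj_on_def assms(2))
  moreover have "card ((\<lambda>r. a * r) ` R \<union> (\<lambda>r. d - b * r) ` R) \<le> CARD('a)"
    by (rule card_mono) simp_all
  ultimately have "card ((\<lambda>r. a * r) ` R \<union> (\<lambda>r. d - b * r) ` R)
      \<noteq> card ((\<lambda>r. a * r) ` R) + card ((\<lambda>r. d - b * r) ` R)"
    using R by linarith
  then have "(\<lambda>r. a * r) ` R \<inter> (\<lambda>r. d - b * r) ` R \<noteq> {}"
    by (metis card_Un_disjoint finite)
  then obtain s t where "a * s\<^sup>2 = d - b * t\<^sup>2" by (auto simp: R_def)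
  then have "a * s\<^sup>2 + b * t\<^sup>2 = d" by simp
  then show ?thesis by blast
qed

section \<open>Isotropic vectors and subspaces\<close>

lemma quad_form_add:
  assumes "transpose A = A"
  shows "quad_form A (x + y) = quad_form A x + quad_form A y + 2 * dot (A *v x) y"
proof -
  have "dot x (A *v y) = dot (A *v x) y"
    by (metis assms dot_matrix_vector)
  moreover have "dot y (A *v x) = dot (A *v x) y"
    by (rule dot_commute)
  ultimately show ?thesis
    by (simp add: quad_form_dot matrix_vector_right_distrib dot_right dot_left)
qed

lemma quad_form_scale:
  fixes A :: "'a::field ^ 'n ^ 'n"
  shows "quad_form A (c *s x) = c\<^sup>2 * quad_form A x"
  by (simp add: quad_form_dot vector_scalar_commute dot_right dot_left mult.assoc power2_eq_square)

lemma card_gt_1_nonzero: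
  assumes "card S > 1"
  shows "\<exists>x\<in>S. x \<noteq> 0"
proof (rule ccontr)
  assume "\<not> ?thesis"
  then have "S \<subseteq> {0}" by auto
  then show False using assms card_mono[of "{0}" S] by simp
qed

lemma card_field_gt_1: "CARD('a::{field,finite}) > 1"
  using card_mono[of UNIV "{0, 1 :: 'a}"] by simp

text \<open>A dimension count in terms of cardinalities. Only \<open>card G \<le> k\<close> is
  asked, so the vectors listed in \<open>G\<close> may coincide.\<close>

lemma card_kernel_ge:
  fixes S :: "('a::{field,finite} ^ 'n) set"
  assumes "finite G" "card G \<le> k" "vec.subspace S" "CARD('a) ^ (k + m) \<le> card S"
  shows "CARD('a) ^ m \<le> card {x\<in>S. \<forall>g\<in>G. dot g x = 0}"
proof -
  have "CARD('a) ^ m * CARD('a) ^ card G \<le> CARD('a) ^ (k + m)"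
    using assms(2) card_field_gt_1[where 'a='a] by (simp flip: power_add add: power_increasing)
  also have "\<dots> \<le> card {x\<in>S. \<forall>g\<in>G. dot (id g) x = 0} * CARD('a) ^ card G"
    using assms(4)
    by (rule order_trans) (intro card_le_kernel assms(1) vec.subspace_diff assms(3))
  finally show ?thesis by simp
qed

text \<open>Choose three nonzero vectors, pairwise orthogonal for \<open>A\<close>; each
  orthogonality condition costs at most one dimension. If none is isotropic, some combination with
  coefficient 1 at the third is, because a binary diagonal form takes every value.\<close>

lemma isotropic_vector:
  fixes S :: "('a::{field,finite} ^ 'n) set"
  assumes S: "vec.subspace S" "CARD('a) ^ 3 \<le> card S" and A: "transpose A = A"
  shows "\<exists>w\<in>S. w \<noteq> 0 \<and> quad_form A w = 0"
proof -
  have q: "CARD('a) > 1" by (rule card_field_gt_1)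
  have "card S > 1" using less_le_trans[OF one_less_power[OF q] S(2)] by simp
  then obtain e1 where e1: "e1 \<in> S" "e1 \<noteq> 0" using card_gt_1_nonzero by blast
  have "CARD('a) ^ 2 \<le> card {x\<in>S. \<forall>g\<in>{A *v e1}. dot g x = 0}"
    using S by (intro card_kernel_ge[of _ 1]) (auto simp: power3_eq_cube power2_eq_square mult.assoc)
  then have "card {x\<in>S. dot (A *v e1) x = 0} > 1"
    using less_le_trans[OF one_less_power[OF q, of 2]] by simp
  then obtain e2 where e2: "e2 \<in> S" "e2 \<noteq> 0" "dot (A *v e1) e2 = 0" using card_gt_1_nonzero by blast
  have "CARD('a) ^ 1 \<le> card {x\<in>S. \<forall>g\<in>{A *v e1, A *v e2}. dot g x = 0}"
    using S by (intro card_kernel_ge[of _ 2]) (auto simp: card_insert_if)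
  then have "card {x\<in>S. dot (A *v e1) x = 0 \<and> dot (A *v e2) x = 0} > 1" using q by simp
  then obtain e3 where e3: "e3 \<in> S" "e3 \<noteq> 0" "dot (A *v e1) e3 = 0" "dot (A *v e2) e3 = 0"
    using card_gt_1_nonzero by blast
  show ?thesis
  proof (cases "quad_form A e1 = 0 \<or> quad_form A e2 = 0 \<or> quad_form A e3 = 0")
    case True
    then show ?thesis using e1 e2 e3 by blast
  next
    case False
    then obtain s t where st: "quad_form A e1 * s\<^sup>2 + quad_form A e2 * t\<^sup>2 = - quad_form A e3"
      using binary_form_universal by blast
    define w where "w = s *s e1 + t *s e2 + e3"
    have "quad_form A w = 0"
      using st e2 e3
      by (simp add: w_def quad_form_add[OF A] quad_form_scale dot_left dot_right
          matrix_vector_right_distrib vector_scalar_commute mult.commute)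
    \<comment> \<open>The cross terms vanish, so pairing with \<open>e3\<close> shows that
      \<open>w\<close> is nonzero.\<close>
    moreover have "dot (A *v e3) w = quad_form A e3"
      using e3 dot_matrix_vector[of e1 A e3] dot_matrix_vector[of e2 A e3]
      by (simp add: w_def dot_right quad_form_dot dot_commute[of "A *v e3"] A)
    then have "w \<noteq> 0" using False by (auto simp: dot_right)
    moreover have "w \<in> S"
      using S(1) e1 e2 e3 by (simp add: w_def vec.subspace_add vec.subspace_scale)
    ultimately show ?thesis by blast
  qed
qed

text \<open>Isotropic vectors are split off one at a time. Each costs two dimensions: orthogonality
  to \<open>w\<close>, and a coordinate condition that separates \<open>w\<close> from the rest. The
  extra \<open>+ 1\<close> leaves dimension at least 3 for every split.\<close>

lemma isotropic_subspace:
  fixes S :: "('a::{field,finite} ^ 'n) set"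
  assumes "vec.subspace S" "CARD('a) ^ (2 * m + 1) \<le> card S" and A: "transpose A = A"
  shows "\<exists>U\<subseteq>S. vec.subspace U \<and> CARD('a) ^ m \<le> card U \<and> (\<forall>x\<in>U. quad_form A x = 0)"
  using assms(1,2)
proof (induction m arbitrary: S)
  case 0
  then show ?case
    by (intro exI[of _ "{0}"]) (auto simp: vec.subspace_0 quad_form_dot dot_right)
next
  case (Suc m)
  have q: "CARD('a) > 1" by (rule card_field_gt_1)
  have "CARD('a) ^ 3 \<le> card S"
    by (rule order_trans[OF power_increasing Suc.prems(2)]) (use q in auto)
  then obtain w where w: "w \<in> S" "w \<noteq> 0" "quad_form A w = 0"
    using isotropic_vector[OF Suc.prems(1) _ A] by blast
  then obtain a where a: "w $ a \<noteq> 0" by (auto simp: vec_eq_iff)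
  define T where "T = {x\<in>S. \<forall>i\<in>{A *v w, axis a 1}. dot i x = 0}"
  have "CARD('a) ^ (2 * m + 1) \<le> card T"
    unfolding T_def using Suc.prems
    by (intro card_kernel_ge[of _ 2]) (auto simp: card_insert_if)
  moreover have T: "vec.subspace T"
    using Suc.prems(1) unfolding T_def vec.subspace_def by (auto simp: dot_right)
  ultimately obtain U where U: "U \<subseteq> T" "vec.subspace U" "CARD('a) ^ m \<le> card U"
    "\<forall>x\<in>U. quad_form A x = 0"
    using Suc.IH by blast
  \<comment> \<open>Coordinate \<open>a\<close> vanishes on \<open>U\<close> but not at
    \<open>w\<close>, so it recovers \<open>t\<close> and the sum is direct.\<close>
  define h where "h = (\<lambda>(u, t). u + t *s w)"
  have Ua: "u $ a = 0" "dot (A *v w) u = 0" if "u \<in> U" for u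
    using U(1) that dot_axis[of u a] by (auto simp: T_def dot_commute)
  have "inj_on h (U \<times> UNIV)"
  proof (rule inj_onI, clarify)
    fix u t u' t' assume *: "u \<in> U" "u' \<in> U" "h (u, t) = h (u', t')"
    have "(u + t *s w) $ a = (u' + t' *s w) $ a" using *(3) by (simp add: h_def)
    then have "t = t'" using *(1,2) a by (simp add: Ua)
    then show "u = u' \<and> t = t'" using *(3) by (simp add: h_def)
  qed
  then have "card (h ` (U \<times> UNIV)) = card U * CARD('a)"
    by (simp add: card_image card_cartesian_product)
  then have "CARD('a) ^ Suc m \<le> card (h ` (U \<times> UNIV))"
    using U(3) by simp
  moreover have "h ` (U \<times> UNIV) \<subseteq> S"
    using U(1) w(1) Suc.prems(1) by (auto simp: h_def T_def vec.subspace_add vec.subspace_scale)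
  moreover have "vec.subspace (h ` (U \<times> UNIV))"
    unfolding vec.subspace_def
  proof (intro conjI ballI allI)
    show "0 \<in> h ` (U \<times> UNIV)"
      by (rule image_eqI[of _ _ "(0, 0)"]) (auto simp: h_def vec.subspace_0 U(2))
  next
    fix x y assume "x \<in> h ` (U \<times> UNIV)" "y \<in> h ` (U \<times> UNIV)"
    then obtain u t u' t' where "u \<in> U" "u' \<in> U" "x = u + t *s w" "y = u' + t' *s w"
      by (auto simp: h_def)
    then show "x + y \<in> h ` (U \<times> UNIV)"
      by (intro image_eqI[of _ _ "(u + u', t + t')"])
         (auto simp: h_def vec.subspace_add U(2) vec.scale_left_distrib)
  next
    fix c x assume "x \<in> h ` (U \<times> UNIV)"
    then obtain u t where "u \<in> U" "x = u + t *s w" by (auto simp: h_def)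
    then show "c *s x \<in> h ` (U \<times> UNIV)"
      by (intro image_eqI[of _ _ "(c *s u, c * t)"])
         (auto simp: h_def vec.subspace_scale U(2) vec.scale_right_distrib)
  qed
  moreover have "quad_form A x = 0" if x: "x \<in> h ` (U \<times> UNIV)" for x
  proof -
    obtain u t where "u \<in> U" "x = u + t *s w" using x by (auto simp: h_def)
    then show ?thesis
      using U(4) w(3) Ua
      by (simp add: add.commute[of u] quad_form_add[OF A] quad_form_scale vector_scalar_commute dot_left)
  qed
  ultimately show ?case by blast
qed

subsection \<open>Nonsingular pencils\<close>

text \<open>\<open>nonsingular\<close> encodes that nontrivial combinations of the
  \<open>M k\<close> are invertible, in contrapositive form so that it delivers vanishing
  coefficients.\<close>

locale nonsingular_pencil =
  fixes M :: "nat \<Rightarrow> 'a::{field,finite} ^ 'n ^ 'n" and K :: "nat set"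
  assumes finite_K: "finite K"
    and symmetric: "k \<in> K \<Longrightarrow> transpose (M k) = M k"
    and nonsingular: "(\<Sum>k\<in>K. d k *s (M k *v x)) = 0 \<Longrightarrow> x \<noteq> 0 \<Longrightarrow> \<forall>k\<in>K. d k = 0"
begin

text \<open>The images \<open>M k *v v i\<close> are treated as a family indexed by pairs, so that
  coinciding images count as dependent.\<close>

definition indep :: "nat \<Rightarrow> (nat \<Rightarrow> 'a ^ 'n) \<Rightarrow> bool" where
  "indep f v \<longleftrightarrow> (\<forall>c. (\<Sum>(i, k)\<in>{..<f} \<times> K. c (i, k) *s (M k *v v i)) = 0
     \<longrightarrow> (\<forall>(i, k)\<in>{..<f} \<times> K. c (i, k) = 0))"

lemma indep_0: "indep 0 v"
  by (simp add: indep_def)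

lemma indep_solvable:
  assumes "indep f v"
  shows "\<exists>x. \<forall>i<f. \<forall>k\<in>K. dot (v i) (M k *v x) = t i k"
proof -
  let ?g = "\<lambda>(i, k). M k *v v i"
  have "\<exists>x. \<forall>p\<in>{..<f} \<times> K. dot (?g p) x = case_prod t p"
  proof (rule dual_system_solvable)
    fix c assume "(\<Sum>p\<in>{..<f} \<times> K. c p *s ?g p) = 0"
    then show "\<forall>p\<in>{..<f} \<times> K. c p = 0"
      using assms by (auto simp: indep_def case_prod_unfold)
  qed (simp add: finite_K)
  then show ?thesis
    by (auto simp: dot_matrix_vector symmetric)
qed

lemma card_solutions_ge:
  assumes "indep f v"
  shows "CARD('a) ^ CARD('n)
    \<le> card {x. \<forall>i<f. \<forall>k\<in>K. dot (v i) (M k *v x) = t i k} * CARD('a) ^ (f * card K)"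
proof -
  let ?g = "\<lambda>(i, k). M k *v v i"
  obtain x0 where "\<forall>i<f. \<forall>k\<in>K. dot (v i) (M k *v x0) = t i k"
    using indep_solvable[OF assms] by blast
  then have "\<forall>p\<in>{..<f} \<times> K. dot (?g p) x0 = case_prod t p"
    by (auto simp: dot_matrix_vector symmetric)
  then have "CARD('a) ^ CARD('n) \<le> card {x. \<forall>p\<in>{..<f} \<times> K. dot (?g p) x = case_prod t p}
      * CARD('a) ^ card ({..<f} \<times> K)"
    by (rule card_le_affine[rotated]) (simp add: finite_K)
  also have "{x. \<forall>p\<in>{..<f} \<times> K. dot (?g p) x = case_prod t p}
      = {x. \<forall>i<f. \<forall>k\<in>K. dot (v i) (M k *v x) = t i k}"
    by (rule Collect_cong) (auto simp: dot_matrix_vector symmetric)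
  finally show ?thesis
    by (simp add: card_cartesian_product)
qed

text \<open>If every \<open>x\<close> in \<open>X\<close> failed, each would satisfy
  \<open>T d x = Y c\<close> with \<open>d\<close> nonzero. The combination given by
  \<open>d\<close> is injective, so \<open>(d, c)\<close> determines \<open>x\<close>, and
  \<open>X\<close> has at most as many elements as there are coefficient choices.\<close>

lemma indep_extend:
  assumes v: "indep f v" and X: "card X > CARD('a) ^ (card K * (f + 1))"
  shows "\<exists>x\<in>X. indep (Suc f) (v(f := x))"
proof (rule ccontr)
  assume none: "\<not> ?thesis"
  define T where "T d x = (\<Sum>k\<in>K. d k *s (M k *v x))" for d x
  define Y where "Y c = (\<Sum>(i, k)\<in>{..<f} \<times> K. c (i, k) *s (M k *v v i))" for c
  have T_cong: "T d x = T d' x" if "\<And>k. k \<in> K \<Longrightarrow> d k = d' k" for d d' x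
    using that by (simp add: T_def)
  have Y_cong: "Y c = Y c'" if "\<And>p. p \<in> {..<f} \<times> K \<Longrightarrow> c p = c' p" for c c'
    unfolding Y_def using that by (intro sum.cong) auto
  have T_diff: "T d (x - y) = T d x - T d y" for d x y
    by (simp add: T_def vec.diff vec.scale_right_diff_distrib sum_subtractf)
  have sum_Suc: "(\<Sum>(i, k)\<in>{..<Suc f} \<times> K. c (i, k) *s (M k *v (v(f := x)) i))
      = Y c + T (\<lambda>k. c (f, k)) x" for c x
  proof -
    have "(\<Sum>(i, k)\<in>{..<Suc f} \<times> K. c (i, k) *s (M k *v (v(f := x)) i))
        = (\<Sum>i<Suc f. \<Sum>k\<in>K. c (i, k) *s (M k *v (v(f := x)) i))"
      by (simp add: sum.cartesian_product)
    also have "\<dots> = (\<Sum>i<f. \<Sum>k\<in>K. c (i, k) *s (M k *v v i)) + T (\<lambda>k. c (f, k)) x"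
      by (simp add: T_def)
    finally show ?thesis by (simp add: Y_def sum.cartesian_product)
  qed
  have "\<exists>d c. d \<in> K \<rightarrow>\<^sub>E UNIV \<and> c \<in> ({..<f} \<times> K) \<rightarrow>\<^sub>E UNIV
      \<and> (\<exists>k\<in>K. d k \<noteq> 0) \<and> T d x = Y c" if "x \<in> X" for x
  proof -
    have "\<not> indep (Suc f) (v(f := x))" using none that by blast
    then obtain c where c: "Y c + T (\<lambda>k. c (f, k)) x = 0"
      and c_nz: "\<not> (\<forall>(i, k)\<in>{..<Suc f} \<times> K. c (i, k) = 0)"
      unfolding indep_def sum_Suc not_all not_imp by (elim exE conjE)
    \<comment> \<open>Restriction makes the coefficients extensional, hence members of finite sets
      of known size.\<close>
    define d where "d = restrict (\<lambda>k. c (f, k)) K"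
    define c' where "c' = restrict (\<lambda>p. - c p) ({..<f} \<times> K)"
    have "T d x = T (\<lambda>k. c (f, k)) x" by (rule T_cong) (simp add: d_def)
    moreover have "Y c' = Y (\<lambda>p. - c p)" by (rule Y_cong) (simp add: c'_def)
    moreover have "Y (\<lambda>p. - c p) = - Y c"
      by (simp add: Y_def case_prod_unfold sum_negf)
    moreover have "T (\<lambda>k. c (f, k)) x = - Y c"
      using c by (simp add: add_eq_0_iff)
    ultimately have "T d x = Y c'" by simp
    moreover have "\<exists>k\<in>K. d k \<noteq> 0"
    proof (rule ccontr)
      assume "\<not> ?thesis"
      then have d0: "\<forall>k\<in>K. c (f, k) = 0" by (simp add: d_def)
      then have "T (\<lambda>k. c (f, k)) x = 0" by (simp add: T_def)
      then have "\<forall>(i, k)\<in>{..<f} \<times> K. c (i, k) = 0"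
        using c v by (simp add: indep_def Y_def)
      with d0 c_nz show False by (auto simp: less_Suc_eq)
    qed
    ultimately show ?thesis
      by (intro exI[of _ d] exI[of _ c']) (simp add: d_def c'_def)
  qed
  then obtain D C where DC: "\<And>x. x \<in> X \<Longrightarrow> D x \<in> K \<rightarrow>\<^sub>E UNIV \<and> C x \<in> ({..<f} \<times> K) \<rightarrow>\<^sub>E UNIV
      \<and> (\<exists>k\<in>K. D x k \<noteq> 0) \<and> T (D x) x = Y (C x)"
    by metis
  have "inj_on (\<lambda>x. (D x, C x)) X"
  proof (rule inj_onI)
    fix x y assume xy: "x \<in> X" "y \<in> X" "(D x, C x) = (D y, C y)"
    then have "T (D x) (x - y) = 0"
      using DC[OF xy(1)] DC[OF xy(2)] by (simp add: T_diff)
    then show "x = y"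
      using nonsingular[of "D x" "x - y"] DC[OF xy(1)] by (auto simp: T_def)
  qed
  moreover have "(\<lambda>x. (D x, C x)) ` X
      \<subseteq> (K \<rightarrow>\<^sub>E (UNIV :: 'a set)) \<times> (({..<f} \<times> K) \<rightarrow>\<^sub>E (UNIV :: 'a set))"
    using DC by (intro image_subsetI) simp
  moreover have "finite ((K \<rightarrow>\<^sub>E (UNIV :: 'a set)) \<times> (({..<f} \<times> K) \<rightarrow>\<^sub>E (UNIV :: 'a set)))"
    by (intro finite_cartesian_product finite_PiE finite_K) simp_all
  ultimately have "card X \<le> card ((K \<rightarrow>\<^sub>E (UNIV :: 'a set)) \<times> (({..<f} \<times> K) \<rightarrow>\<^sub>E (UNIV :: 'a set)))"
    by (rule card_inj_on_le)
  also have "\<dots> = CARD('a) ^ (card K * (f + 1))"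
    by (simp add: card_cartesian_product card_PiE finite_K power_add mult.commute)
  finally show False using X by simp
qed

text \<open>The prescribed products cut out at least \<open>q ^ (n - f * card K)\<close> vectors,
  where \<open>q\<close> is the field size and \<open>n\<close> the dimension; the bound on
  \<open>f\<close> makes this exceed the threshold of \<open>indep_extend\<close>.\<close>

lemma indep_extend_prescribed:
  assumes v: "indep f v" and f: "card K * (2 * f + 1) < CARD('n)"
  shows "\<exists>x. (\<forall>i<f. \<forall>k\<in>K. dot (v i) (M k *v x) = t i k) \<and> indep (Suc f) (v(f := x))"
proof -
  let ?X = "{x. \<forall>i<f. \<forall>k\<in>K. dot (v i) (M k *v x) = t i k}"
  have "CARD('a) ^ (card K * (f + 1)) * CARD('a) ^ (f * card K) < CARD('a) ^ CARD('n)"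
    unfolding power_add[symmetric]
    using f card_field_gt_1[where 'a='a]
    by (intro power_strict_increasing) (simp_all add: algebra_simps)
  also have "\<dots> \<le> card ?X * CARD('a) ^ (f * card K)"
    by (rule card_solutions_ge[OF v])
  finally have "card ?X > CARD('a) ^ (card K * (f + 1))" by simp
  from indep_extend[OF v this] show ?thesis by auto
qed

end

section \<open>Prescribing the values of two forms on a grid\<close>

lemma isotropic_imp_orthogonal:
  fixes A :: "'a::field ^ 'n ^ 'n"
  assumes "transpose A = A" "(2 :: 'a) \<noteq> 0" "vec.subspace U" "\<forall>x\<in>U. quad_form A x = 0"
    and "x \<in> U" "y \<in> U"
  shows "dot x (A *v y) = 0"
proof -
  have "x + y \<in> U" using assms by (simp add: vec.subspace_add)
  then have "2 * dot (A *v x) y = 0"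
    using assms quad_form_add[OF assms(1), of x y] by simp
  then show ?thesis using assms(1,2) by (simp add: dot_matrix_vector)
qed

locale nonsingular_pair = nonsingular_pencil M "{1, 2}"
  for M :: "nat \<Rightarrow> 'a::{field,finite} ^ 'n ^ 'n" +
  assumes two_nonzero: "(2 :: 'a) \<noteq> 0"
    and dim: "CARD('n) \<ge> 31"
begin

text \<open>Dimension 23 gives 11 for the first form and then 5 for both. Five is enough: the choice
  of the second vector needs dimension above 4.\<close>

lemma isotropic_pair:
  "\<exists>v. indep 2 v \<and> (\<forall>i<2. \<forall>j<2. \<forall>k\<in>{1, 2}. dot (v i) (M k *v v j) = 0)"
proof -
  have q: "CARD('a) > 1" by (rule card_field_gt_1)
  have "CARD('a) ^ (2 * 11 + 1) \<le> card (UNIV :: ('a ^ 'n) set)"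
    unfolding CARD_vec using dim q by (intro power_increasing) auto
  then obtain U1 where U1: "vec.subspace U1" "CARD('a) ^ (2 * 5 + 1) \<le> card U1"
      "\<forall>x\<in>U1. quad_form (M 1) x = 0"
    using isotropic_subspace[of UNIV 11 "M 1"] symmetric[of 1] by auto
  from U1(1,2) symmetric[of 2] obtain U where U: "U \<subseteq> U1" "vec.subspace U" "CARD('a) ^ 5 \<le> card U"
      "\<forall>x\<in>U. quad_form (M 2) x = 0"
    using isotropic_subspace[of U1 5 "M 2"] by auto
  have orth: "dot x (M k *v y) = 0" if "x \<in> U" "y \<in> U" "k \<in> {1, 2}" for x y k
    using isotropic_imp_orthogonal[OF symmetric[OF that(3)] two_nonzero U(2) _ that(1,2)]
      U(1,4) U1(3) that(3) by auto
  have big: "card U > CARD('a) ^ (card {1, 2 :: nat} * (f + 1))" if "f < 2" for f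
  proof -
    have "CARD('a) ^ (card {1, 2 :: nat} * (f + 1)) < CARD('a) ^ 5"
      using that q by (intro power_strict_increasing) auto
    then show ?thesis using U(3) by simp
  qed
  obtain x where x: "x \<in> U" "indep 1 ((\<lambda>_. 0)(0 := x))"
    using indep_extend[OF indep_0 big, of "\<lambda>_. 0"] by auto
  obtain y where y: "y \<in> U" "indep 2 ((\<lambda>_. 0)(0 := x, 1 := y))"
    using indep_extend[OF x(2) big] by (auto simp: numeral_2_eq_2)
  show ?thesis
  proof (intro exI conjI allI ballI impI)
    show "indep 2 ((\<lambda>_. 0)(0 := x, 1 := y))" by (rule y(2))
  next
    fix i j k :: nat assume "i < 2" "j < 2" "k \<in> {1, 2}"
    then show "dot (((\<lambda>_. 0)(0 := x, 1 := y)) i) (M k *v ((\<lambda>_. 0)(0 := x, 1 := y)) j) = 0"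
      using orth x(1) y(1) by (auto simp: less_2_cases_iff)
  qed
qed

text \<open>Vectors 0 and 1 are the isotropic pair; the later ones are appended singly, with
  prescribed products against all earlier ones.\<close>

lemma prescribed_family:
  assumes "2 \<le> f" "f \<le> 8"
  shows "\<exists>v. indep f v
    \<and> (\<forall>i<2. \<forall>j<2. \<forall>k\<in>{1, 2}. dot (v i) (M k *v v j) = 0)
    \<and> (\<forall>j\<in>{2..<f}. \<forall>i<j. \<forall>k\<in>{1, 2}. dot (v i) (M k *v v j) = \<tau> k i j)"
  using assms
proof (induction f rule: dec_induct)
  case base
  then show ?case using isotropic_pair by simp
next
  case (step f)
  then obtain v where v: "indep f v"
    "\<And>i j k. i < 2 \<Longrightarrow> j < 2 \<Longrightarrow> k \<in> {1, 2} \<Longrightarrow> dot (v i) (M k *v v j) = 0"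
    "\<And>j i k. j \<in> {2..<f} \<Longrightarrow> i < j \<Longrightarrow> k \<in> {1, 2} \<Longrightarrow> dot (v i) (M k *v v j) = \<tau> k i j"
    by (meson Suc_leD)
  \<comment> \<open>The worst case is \<open>f = 7\<close> with left side 30, which is the origin of
    the bound 31.\<close>
  have "card {1, 2 :: nat} * (2 * f + 1) < CARD('n)"
    using step.prems dim by simp
  from indep_extend_prescribed[OF v(1) this, of "\<lambda>i k. \<tau> k i f"] obtain x where
    x: "\<And>i k. i < f \<Longrightarrow> k \<in> {1, 2} \<Longrightarrow> dot (v i) (M k *v x) = \<tau> k i f"
      "indep (Suc f) (v(f := x))"
    by blast
  show ?case
  proof (intro exI[of _ "v(f := x)"] conjI ballI allI impI)
    fix i j k :: nat assume "i < 2" "j < 2" "k \<in> {1, 2}"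
    then show "dot ((v(f := x)) i) (M k *v (v(f := x)) j) = 0"
      using v(2) step.hyps(1) by simp
  next
    fix i j k :: nat assume *: "j \<in> {2..<Suc f}" "i < j" "k \<in> {1, 2}"
    then have "i \<noteq> f" by simp
    then show "dot ((v(f := x)) i) (M k *v (v(f := x)) j) = \<tau> k i j"
      using * v(3)[of j i k] x(1)[of i k] by (cases "j = f") simp_all
  qed (rule x(2))
qed

text \<open>The vectors \<open>x\<close> and \<open>y\<close> are fixed before
  \<open>\<alpha>\<close> and \<open>\<beta>\<close>, as the dimension requires. Only the products
  of \<open>x i\<close> with \<open>y j\<close> couple \<open>i\<close> and \<open>j\<close>; the
  remaining terms split into row and column terms that \<open>z\<close> adjusts.\<close>

lemma grid_values:
  fixes m :: "nat \<Rightarrow> nat \<Rightarrow> nat \<Rightarrow> 'a"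
  shows "\<exists>x y :: nat \<Rightarrow> 'a ^ 'n. \<forall>\<alpha> \<beta>. \<exists>z. \<forall>k\<in>{1, 2}. \<forall>i<3. \<forall>j<3.
    quad_form (M k) (x i + y j + z) = \<alpha> k i + \<beta> k j + m k i j"
proof -
  \<comment> \<open>Slots 0 and 1 are isotropic, 2 to 4 hold \<open>x\<close>, 5 to 7 hold
    \<open>y\<close>. Halving offsets the factor 2 of polarization.\<close>
  define \<tau> where "\<tau> k i j = (if 2 \<le> i \<and> i < 5 \<and> 5 \<le> j then m k (i - 2) (j - 5) / 2 else 0)" for k i j
  have "(2 :: nat) \<le> 8" by simp
  from prescribed_family[OF this order_refl, of \<tau>] obtain v where v1: "indep 8 v"
    and v2: "\<forall>i<2. \<forall>j<2. \<forall>k\<in>{1, 2}. dot (v i) (M k *v v j) = 0"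
    and v3: "\<forall>j\<in>{2..<8}. \<forall>i<j. \<forall>k\<in>{1, 2}. dot (v i) (M k *v v j) = \<tau> k i j"
    by (elim exE conjE)
  note v = v1 v2[rule_format] v3[rule_format]
  define x where "x i = v (i + 2)" for i
  define y where "y i = v (i + 5)" for i
  have xy: "dot (x i) (M k *v y j) = m k i j / 2" if "i < 3" "j < 3" "k \<in> {1, 2}" for i j k
    using v(3)[of "j + 5" "i + 2" k] that by (simp add: x_def y_def \<tau>_def)
  have vx: "dot (v l) (M k *v x i) = 0" and vy: "dot (v l) (M k *v y i) = 0"
    if "l < 2" "i < 3" "k \<in> {1, 2}" for l i k
    using v(3)[of "i + 2" l k] v(3)[of "i + 5" l k] that by (simp_all add: x_def y_def \<tau>_def)
  have sym: "dot b (M k *v a) = dot a (M k *v b)" if "k \<in> {1, 2}" for a b k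
    using symmetric[OF that] by (metis dot_commute dot_matrix_vector)
  have R: "\<exists>z. \<forall>k\<in>{1, 2}. \<forall>i<3. \<forall>j<3.
      quad_form (M k) (x i + y j + z) = \<alpha> k i + \<beta> k j + m k i j" for \<alpha> \<beta>
  proof -
    \<comment> \<open>On the isotropic slots \<open>t\<close> is the identity: \<open>v 0\<close>
      pairs with \<open>w\<close> only under the first form and \<open>v 1\<close> only under the
      second, so the two values can be corrected independently.\<close>
    define t where "t i k = (if i < 2 then if k = i + 1 then 1 else 0
      else if i < 5 then (\<alpha> k (i - 2) - quad_form (M k) (v i)) / 2
      else (\<beta> k (i - 5) - quad_form (M k) (v i)) / 2)" for i k :: nat
    obtain w where w: "\<And>i k. i < 8 \<Longrightarrow> k \<in> {1, 2} \<Longrightarrow> dot (v i) (M k *v w) = t i k"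
      using indep_solvable[OF v(1), of t] by blast
    text \<open>The linear conditions on \<open>w\<close> survive adding a combination \<open>u\<close> of the common isotropic
      vectors \<open>v 0\<close> and \<open>v 1\<close>, whose only effect is to change the two values at \<open>w\<close> linearly.\<close>
    define s where "s k = - quad_form (M k) w / 2" for k
    define u where "u = s 1 *s v 0 + s 2 *s v 1"
    define z where "z = u + w"
    have uu: "quad_form (M k) u = 0" if "k \<in> {1, 2}" for k
      using that v(2)
      by (simp add: u_def quad_form_dot dot_left dot_right matrix_vector_right_distrib vector_scalar_commute)
    have uw: "dot u (M k *v w) = s k" if "k \<in> {1, 2}" for k
      using that w[of 0 k] w[of 1 k] by (auto simp: u_def dot_left t_def numeral_2_eq_2)
    have z0: "quad_form (M k) z = 0" if "k \<in> {1, 2}" for k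
      using quad_form_add[OF symmetric[OF that], of u w] that uu uw two_nonzero
      by (simp add: z_def s_def dot_matrix_vector symmetric)
    have ux: "dot u (M k *v x i) = 0" "dot u (M k *v y i) = 0" if "k \<in> {1, 2}" "i < 3" for k i
      using vx[of _ i k] vy[of _ i k] that by (simp_all add: u_def dot_left)
    have xz: "2 * dot (x i) (M k *v z) = \<alpha> k i - quad_form (M k) (x i)" if "k \<in> {1, 2}" "i < 3" for k i
      using w[of "i + 2" k] ux(1)[OF that] that two_nonzero
      by (simp add: z_def matrix_vector_right_distrib dot_right t_def sym[OF that(1), of "x i" u]) (simp add: x_def mult.commute)
    have yz: "2 * dot (y i) (M k *v z) = \<beta> k i - quad_form (M k) (y i)" if "k \<in> {1, 2}" "i < 3" for k i
      using w[of "i + 5" k] ux(2)[OF that] that two_nonzero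
      by (simp add: z_def matrix_vector_right_distrib dot_right t_def sym[OF that(1), of "y i" u]) (simp add: y_def mult.commute)
    have "quad_form (M k) (x i + y j + z) = \<alpha> k i + \<beta> k j + m k i j"
      if "k \<in> {1, 2}" "i < 3" "j < 3" for k i j
    proof -
      note S = symmetric[OF that(1)]
      have "quad_form (M k) (x i + y j + z) = quad_form (M k) (x i) + quad_form (M k) (y j)
          + 2 * dot (x i) (M k *v y j) + quad_form (M k) z
          + (2 * dot (x i) (M k *v z) + 2 * dot (y j) (M k *v z))"
        by (simp add: quad_form_add[OF S] matrix_vector_right_distrib dot_left dot_matrix_vector S distrib_left)
      then show ?thesis
        using xy[OF that(2,3,1)] z0[OF that(1)] xz[OF that(1,2)] yz[OF that(1,3)] two_nonzero by simp
    qed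
    then show ?thesis by blast
  qed
  show ?thesis
    by (rule exI[of _ x], rule exI[of _ y]) (intro allI R)
qed

end

subsection \<open>Patterns on the grid\<close>

text \<open>The status of an integer value of the first form: \<open>0\<close> passes the decision on to the second
  form, \<open>1\<close> puts the point into the set, \<open>Out\<close> stands for a residue other than \<open>0\<close> and \<open>1\<close>, and
  \<open>Bad\<close> for an integer whose residue depends on the prime.\<close>

datatype cell = Undecided | In | Out | Bad

fun decides :: "cell \<Rightarrow> bool \<Rightarrow> bool" where
  "decides Undecided b = True"
| "decides In b = b"
| "decides Out b = (\<not> b)"
| "decides Bad b = False"

definition grid :: "(nat \<times> nat) list" where
  "grid = List.product [0..<3] [0..<3]"

lemma set_grid: "set grid = {..<3} \<times> {..<3}"
  by (simp add: grid_def atLeast0LessThan)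

definition entry :: "int list list \<Rightarrow> int list \<times> int list \<Rightarrow> nat \<times> nat \<Rightarrow> int" where
  "entry m e = (\<lambda>(i, j). fst e ! i + snd e ! j + m ! i ! j)"

text \<open>Every edge has an endpoint that does not occur later in the list, so the sums \<open>\<alpha> i + \<beta> j\<close> can
  be prescribed edge by edge from the end. This is sufficient for the bipartite graph to be a
  forest, and necessary only up to reordering the list.\<close>

fun forest :: "(nat \<times> nat) list \<Rightarrow> bool" where
  "forest [] = True"
| "forest ((i, j) # es) = ((i \<notin> set (map fst es) \<or> j \<notin> set (map snd es)) \<and> forest es)"

text \<open>A pattern is a list of truth values in the order of \<open>grid\<close>; for a symbolic
  pattern this form simplifies to propositional logic.\<close>

definition covers :: "(int \<Rightarrow> cell) \<Rightarrow> int list list \<Rightarrow> (int list \<times> int list) list \<Rightarrow> bool list \<Rightarrow> bool" where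
  "covers cls m tab bs \<longleftrightarrow> list_ex (\<lambda>e. list_all2 decides (map (\<lambda>p. cls (entry m e p)) grid) bs) tab"

definition acyclic_zeros :: "(int \<Rightarrow> cell) \<Rightarrow> int list list \<Rightarrow> (int list \<times> int list) list \<Rightarrow> bool" where
  "acyclic_zeros cls m tab \<longleftrightarrow>
    list_all (\<lambda>e. forest (filter (\<lambda>p. cls (entry m e p) = Undecided) grid)) tab"

text \<open>The endpoint that is new to the rest of the list carries a free summand, which is set to
  satisfy the added edge.\<close>

lemma forest_solvable:
  fixes f :: "nat \<Rightarrow> nat \<Rightarrow> 'a::ab_group_add"
  assumes "forest es"
  shows "\<exists>\<alpha> \<beta>. \<forall>(i, j)\<in>set es. \<alpha> i + \<beta> j = f i j"
  using assms
proof (induction es rule: forest.induct)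
  case 1
  then show ?case by simp
next
  case (2 a b es)
  then have leaf: "a \<notin> fst ` set es \<or> b \<notin> snd ` set es" and "forest es" by auto
  from "2.IH"[OF \<open>forest es\<close>] obtain \<alpha> \<beta> where ab: "\<forall>(i, j)\<in>set es. \<alpha> i + \<beta> j = f i j"
    by (elim exE)
  show ?case
  proof (cases "a \<in> fst ` set es")
    case False
    have "(\<alpha>(a := f a b - \<beta> b)) i + \<beta> j = f i j" if "(i, j) \<in> set ((a, b) # es)" for i j
    proof (cases "(i, j) = (a, b)")
      case ne: False
      then have "(i, j) \<in> set es" using that by auto
      moreover from this have "i \<noteq> a" using False by force
      ultimately show ?thesis using ab by auto
    qed simp
    then have "\<forall>(i, j)\<in>set ((a, b) # es). (\<alpha>(a := f a b - \<beta> b)) i + \<beta> j = f i j" by blast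
    then show ?thesis by (intro exI)
  next
    case True
    have "\<alpha> i + (\<beta>(b := f a b - \<alpha> a)) j = f i j" if "(i, j) \<in> set ((a, b) # es)" for i j
    proof (cases "(i, j) = (a, b)")
      case ne: False
      then have "(i, j) \<in> set es" using that by auto
      moreover from this have "j \<noteq> b" using leaf True by force
      ultimately show ?thesis using ab by auto
    qed simp
    then have "\<forall>(i, j)\<in>set ((a, b) # es). \<alpha> i + (\<beta>(b := f a b - \<alpha> a)) j = f i j" by blast
    then show ?thesis by (intro exI)
  qed
qed

text \<open>Membership settled by the values of the first two forms alone. The negative case
  excludes \<open>u = w = 0\<close>, which would defer to the third form.\<close>

definition decided :: "bool \<Rightarrow> 'a::zero_neq_one \<Rightarrow> 'a \<Rightarrow> bool" where
  "decided b u w \<longleftrightarrow> (if b then u = 1 \<or> u = 0 \<and> w = 1 else u \<noteq> 1 \<and> (u = 0 \<longrightarrow> w \<noteq> 0 \<and> w \<noteq> 1))"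

definition represents :: "(int \<Rightarrow> cell) \<Rightarrow> 'a::field itself \<Rightarrow> bool" where
  "represents cls F \<longleftrightarrow> (\<forall>u. (cls u = Undecided \<longrightarrow> of_int u = (0 :: 'a))
    \<and> (cls u = In \<longrightarrow> of_int u = (1 :: 'a))
    \<and> (cls u = Out \<longrightarrow> of_int u \<noteq> (0 :: 'a) \<and> of_int u \<noteq> (1 :: 'a)))"

text \<open>A table entry fixes the first form. On its zero cells, a forest, the second form can be
  made \<open>1\<close> for members and \<open>-1\<close> for non-members, whatever the interaction
  \<open>w\<close>.\<close>

lemma covers_realizes:
  fixes w :: "nat \<Rightarrow> nat \<Rightarrow> 'a::field"
  assumes cls: "represents cls TYPE('a)" and two: "(2 :: 'a) \<noteq> 0"
    and cov: "covers cls m tab (map (\<lambda>(i, j). P i j) grid)" and acyclic: "acyclic_zeros cls m tab"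
  shows "\<exists>\<alpha> \<beta> \<alpha>' \<beta>'. \<forall>i<3. \<forall>j<3.
    decided (P i j) (\<alpha> i + \<beta> j + of_int (m ! i ! j)) (\<alpha>' i + \<beta>' j + w i j)"
proof -
  from cov obtain e where e: "e \<in> set tab"
    "list_all2 decides (map (\<lambda>p. cls (entry m e p)) grid) (map (\<lambda>(i, j). P i j) grid)"
    by (auto simp: covers_def list_ex_iff)
  then have "\<forall>(i, j)\<in>{..<3} \<times> {..<3}. decides (cls (entry m e (i, j))) (P i j)"
    by (simp add: list_all2_map1 list_all2_map2 list_all2_same set_grid case_prod_unfold)
  then have dec: "decides (cls (entry m e (i, j))) (P i j)" if "i < 3" "j < 3" for i j
    using that by simp
  let ?Z = "filter (\<lambda>p. cls (entry m e p) = Undecided) grid"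
  have "forest ?Z"
    using acyclic e(1) by (simp add: acyclic_zeros_def list_all_iff)
  then have "\<exists>\<alpha> \<beta>. \<forall>(i, j)\<in>set ?Z. \<alpha> i + \<beta> j = (if P i j then 1 else - 1) - w i j"
    by (rule forest_solvable)
  then obtain \<alpha>' \<beta>' where ab: "\<forall>(i, j)\<in>set ?Z. \<alpha>' i + \<beta>' j = (if P i j then 1 else - 1) - w i j"
    by (elim exE)
  have neg1: "(- 1 :: 'a) \<noteq> 1" using two by (simp add: neg_eq_iff_add_eq_0)
  have rep: "cls n = Undecided \<Longrightarrow> of_int n = (0 :: 'a)" "cls n = In \<Longrightarrow> of_int n = (1 :: 'a)"
    "cls n = Out \<Longrightarrow> of_int n \<noteq> (0 :: 'a) \<and> of_int n \<noteq> (1 :: 'a)" for n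
    using cls by (simp_all add: represents_def)
  have "decided (P i j) (of_int (fst e ! i) + of_int (snd e ! j) + of_int (m ! i ! j)) (\<alpha>' i + \<beta>' j + w i j)"
    if ij: "i < 3" "j < 3" for i j
  proof -
    have u: "of_int (fst e ! i) + of_int (snd e ! j) + of_int (m ! i ! j) = (of_int (entry m e (i, j)) :: 'a)"
      by (simp add: entry_def)
    show ?thesis
    proof (cases "cls (entry m e (i, j))")
      case Undecided
      then have "(i, j) \<in> set ?Z" using ij by (simp add: set_grid)
      from bspec[OF ab this] have "\<alpha>' i + \<beta>' j + w i j = (if P i j then 1 else - 1)" by simp
      then show ?thesis
        using neg1 by (simp add: u decided_def rep(1)[OF Undecided])
    next
      case In
      then show ?thesis using dec[OF ij] by (simp add: u decided_def rep(2)[OF In])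
    next
      case Out
      then show ?thesis using dec[OF ij] rep(3)[OF Out] by (simp add: u decided_def)
    next
      case Bad
      then show ?thesis using dec[OF ij] by simp
    qed
  qed
  then show ?thesis
    by (intro exI[of _ "\<lambda>i. of_int (fst e ! i)"] exI[of _ "\<lambda>j. of_int (snd e ! j)"]
        exI[of _ \<alpha>'] exI[of _ \<beta>']) simp
qed

section \<open>Residue classes and the search tables\<close>

definition cls3 :: "int \<Rightarrow> cell" where
  "cls3 u = (if u mod 3 = 0 then Undecided else if u mod 3 = 1 then In else Out)"

text \<open>The window from \<open>-3\<close> to \<open>4\<close> is where \<open>u\<close> and
  \<open>u - 1\<close> both have absolute value below 5, so no prime from 5 on divides either of
  them unless it is zero.\<close>

definition cls5 :: "int \<Rightarrow> cell" where
  "cls5 u = (if u = 0 then Undecided else if u = 1 then In else if -3 \<le> u \<and> u \<le> 4 then Out else Bad)"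

text \<open>Both tables come from a computer search. Each entry lists \<open>\<alpha>\<close> and \<open>\<beta>\<close> for the first form, and a
  pattern is covered if some entry contradicts it nowhere. The cells with value \<open>0\<close> form a forest, so
  that the second form can settle them arbitrarily.\<close>

definition table3 :: "(int list \<times> int list) list" where
  "table3 = [([0,0,-1],[0,0,0]), ([0,0,0],[0,0,-1]), ([0,0,0],[0,0,1]), ([0,0,1],[0,0,0]),
    ([-1,-1,0],[0,0,0]), ([-1,0,-1],[0,0,0]), ([-1,0,0],[0,0,-1]), ([0,-1,0],[0,0,-1]),
    ([0,0,-1],[0,-1,0]), ([0,0,-1],[0,1,0]), ([0,0,0],[0,1,1]), ([0,0,1],[0,0,1]),
    ([0,1,0],[0,0,-1]), ([0,1,0],[0,0,1]), ([0,1,0],[0,1,0]), ([1,0,0],[0,0,-1]),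
    ([1,0,1],[0,0,0]), ([-1,-1,-1],[0,0,0]), ([-1,-1,0],[0,-1,0]), ([-1,-1,0],[0,0,-1]),
    ([-1,0,-1],[0,-1,0]), ([-1,1,0],[0,-1,0]), ([-1,1,0],[0,0,-1]), ([0,-1,0],[0,-1,1]),
    ([0,-1,1],[0,-1,0]), ([0,1,0],[0,-1,-1]), ([0,1,1],[0,1,0]), ([1,-1,-1],[0,0,0]),
    ([1,-1,0],[0,0,-1]), ([1,0,-1],[0,-1,0]), ([1,0,0],[0,1,-1]), ([1,0,0],[0,1,1]),
    ([1,0,1],[0,1,0]), ([1,1,0],[0,0,-1]), ([-1,-1,-1],[0,0,1]), ([-1,0,-1],[0,-1,-1]),
    ([-1,0,1],[0,-1,-1]), ([-1,1,-1],[0,0,1]), ([-1,1,-1],[0,1,0]), ([0,-1,-1],[0,1,1]),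
    ([0,-1,1],[0,-1,1]), ([0,1,1],[0,-1,-1]), ([0,1,1],[0,1,1]), ([1,-1,0],[0,-1,1]),
    ([1,-1,0],[0,1,1]), ([1,0,-1],[0,-1,1]), ([1,0,-1],[0,1,-1]), ([1,0,1],[0,-1,1]),
    ([1,0,1],[0,1,-1]), ([1,1,0],[0,-1,-1]), ([1,1,0],[0,1,-1]), ([-1,-1,1],[0,-1,1]),
    ([-1,-1,1],[0,1,1]), ([-1,1,-1],[0,-1,1]), ([-1,1,1],[0,-1,-1]), ([-1,1,1],[0,1,-1]),
    ([1,1,1],[0,1,1])]"

definition table5 :: "(int list \<times> int list) list" where
  "table5 = [([0,0,-1],[0,1,0]), ([0,0,1],[0,-1,0]), ([0,0,1],[0,1,0]), ([0,1,0],[0,-1,0]),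
    ([0,1,0],[0,1,0]), ([-1,0,1],[0,-1,0]), ([-1,0,1],[0,1,0]), ([-1,1,0],[0,-1,0]),
    ([-1,1,0],[0,1,0]), ([0,-1,0],[0,1,1]), ([0,-1,1],[0,0,-1]), ([0,0,-1],[0,1,1]),
    ([0,0,0],[0,1,-2]), ([0,0,1],[0,1,1]), ([0,1,-1],[0,0,-1]), ([0,1,1],[0,0,-1]),
    ([1,0,1],[0,-1,0]), ([1,0,1],[0,0,-1]), ([1,1,0],[0,-1,0]), ([-2,-1,0],[0,1,0]),
    ([-1,-1,0],[0,1,1]), ([-1,0,-1],[0,1,1]), ([-1,0,1],[0,1,1]), ([-1,1,0],[0,1,1]),
    ([0,-1,0],[0,1,2]), ([0,-1,1],[0,1,-1]), ([0,0,-1],[0,1,2]), ([0,1,1],[0,1,-1]),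
    ([0,1,2],[0,-1,0]), ([0,1,2],[0,0,-1]), ([0,2,1],[0,-1,0]), ([0,2,1],[0,0,-1]),
    ([1,-1,0],[0,1,1]), ([1,0,0],[0,-1,-2]), ([1,0,0],[0,1,-2]), ([1,0,1],[0,-1,1]),
    ([1,0,1],[0,1,-1]), ([1,1,0],[0,-1,-1]), ([1,1,0],[0,-1,1]), ([1,1,0],[0,1,-1]),
    ([-2,0,-1],[0,1,1]), ([-1,-2,0],[0,2,0]), ([-1,0,-2],[0,2,0]), ([0,1,2],[0,-1,-1]),
    ([0,1,2],[0,1,-1]), ([0,2,1],[0,-1,-1]), ([0,2,1],[0,1,-1]), ([0,2,2],[0,0,-1]),
    ([1,1,1],[0,-1,1]), ([1,1,2],[0,-1,0]), ([1,2,0],[0,0,-2]), ([2,0,1],[0,-1,-1]),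
    ([-2,1,1],[0,-1,1]), ([0,-2,1],[0,2,-1]), ([1,0,2],[0,-1,-2]), ([1,1,2],[0,-1,-1]),
    ([1,2,0],[0,-1,-2]), ([1,2,1],[0,-1,-1]), ([2,0,0],[0,1,-3]), ([-3,-2,0],[0,0,2]),
    ([-3,0,-2],[0,0,2]), ([0,2,2],[0,-2,-1]), ([1,0,3],[0,-1,-2]), ([1,2,0],[0,-2,-2]),
    ([1,2,2],[0,-1,-2]), ([2,1,1],[0,-1,-3]), ([2,1,2],[0,-1,-2]), ([2,2,1],[0,-1,-2]),
    ([1,2,3],[0,-1,-2]), ([1,3,2],[0,-1,-2]), ([2,0,3],[0,-2,-3])]"

lemma length_grid_cases:
  assumes "length bs = length grid"
  obtains b1 b2 b3 b4 b5 b6 b7 b8 b9 where "bs = [b1, b2, b3, b4, b5, b6, b7, b8, b9]"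
proof -
  have "length bs = Suc (Suc (Suc (Suc (Suc (Suc (Suc (Suc (Suc 0))))))))"
    using assms by (simp add: grid_def)
  then show thesis by (auto simp: length_Suc_conv intro: that)
qed

text \<open>On nine symbolic truth values the table evaluates to a disjunction of conjunctions of
  literals, which a SAT solver proves to be a tautology.\<close>

lemma covers_table3:
  assumes "length bs = length grid"
  shows "covers cls3 [[1,0,0], [0,1,0], [0,0,1]] table3 bs"
proof -
  obtain b1 b2 b3 b4 b5 b6 b7 b8 b9 where bs: "bs = [b1, b2, b3, b4, b5, b6, b7, b8, b9]"
    using assms by (rule length_grid_cases)
  show ?thesis
    unfolding bs
    by (simp add: covers_def table3_def grid_def upt_rec entry_def cls3_def) satx
qed

lemma acyclic_table3: "acyclic_zeros cls3 [[1,0,0], [0,1,0], [0,0,1]] table3"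
  by (simp add: acyclic_zeros_def table3_def grid_def upt_rec entry_def cls3_def)

lemma covers_table5:
  assumes "length bs = length grid"
    and "bs \<noteq> [True, True, False, True, False, True, False, True, True]"
    and "bs \<noteq> [True, True, False, False, True, True, True, False, True]"
  shows "covers cls5 [[0,0,1], [0,0,0], [0,0,0]] table5 bs"
proof -
  obtain b1 b2 b3 b4 b5 b6 b7 b8 b9 where bs: "bs = [b1, b2, b3, b4, b5, b6, b7, b8, b9]"
    using assms(1) by (rule length_grid_cases)
  show ?thesis
    using assms(2,3) unfolding bs
    by (simp add: covers_def table5_def grid_def upt_rec entry_def cls5_def) satx
qed

lemma acyclic_table5: "acyclic_zeros cls5 [[0,0,1], [0,0,0], [0,0,0]] table5"
  by (simp add: acyclic_zeros_def table5_def grid_def upt_rec entry_def cls5_def)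

section \<open>Realizing all patterns modulo the prime\<close>

lemma of_int_mod_ring_eq_0_iff:
  "(of_int u :: 'p::prime_card mod_ring) = 0 \<longleftrightarrow> int CARD('p) dvd u"
  by transfer (simp add: dvd_eq_mod_eq_0)

lemma of_int_mod_ring_eq_1_iff:
  "(of_int u :: 'p::prime_card mod_ring) = 1 \<longleftrightarrow> int CARD('p) dvd u - 1"
  using of_int_mod_ring_eq_0_iff[of "u - 1", where 'p = 'p] by simp

lemma two_mod_ring_nonzero:
  assumes "CARD('p::prime_card) > 2"
  shows "(2 :: 'p mod_ring) \<noteq> 0"
  using of_int_mod_ring_eq_0_iff[of 2, where 'p = 'p] assms zdvd_imp_le[of "int CARD('p)" 2] by auto

lemma represents_cls3:
  assumes "CARD('p::prime_card) = 3"
  shows "represents cls3 TYPE('p mod_ring)"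
  unfolding represents_def of_int_mod_ring_eq_0_iff of_int_mod_ring_eq_1_iff assms cls3_def
  by (auto split: if_splits; presburger)

lemma small_not_dvd:
  fixes u p :: int
  assumes "p \<ge> 5" "\<bar>u\<bar> < 5" "u \<noteq> 0"
  shows "\<not> p dvd u"
  using assms dvd_imp_le_int[of u p] by auto

lemma represents_cls5:
  assumes "CARD('p::prime_card) \<ge> 5"
  shows "represents cls5 TYPE('p mod_ring)"
  unfolding represents_def of_int_mod_ring_eq_0_iff of_int_mod_ring_eq_1_iff
proof (intro allI conjI impI)
  fix u
  assume "cls5 u = Out"
  then have u: "-3 \<le> u" "u \<le> 4" "u \<noteq> 0" "u \<noteq> 1" by (auto simp: cls5_def split: if_splits)
  show "\<not> int CARD('p) dvd u" "\<not> int CARD('p) dvd u - 1"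
    using small_not_dvd[of "int CARD('p)" u] small_not_dvd[of "int CARD('p)" "u - 1"] assms u by auto
qed (auto simp: cls5_def split: if_splits)

text \<open>Interaction terms of the second form. They matter only for the two patterns missing from
  \<open>table5\<close>, where the cells left open by the first form contain cycles.\<close>

definition level2_matrix :: "int list list" where
  "level2_matrix = [[0, 0, 0], [1, -1, 1], [-1, 1, 1]]"

lemma all_less_3: "(\<forall>i<3. Q i) \<longleftrightarrow> Q 0 \<and> Q 1 \<and> Q (2 :: nat)"
  by (simp add: numeral_3_eq_3 numeral_2_eq_2 All_less_Suc conj_ac)

text \<open>The first form takes the values 1, 1, 2 in the top row and vanishes on the other six
  cells, whose graph contains cycles. There \<open>level2_matrix\<close> supplies the interaction
  that row and column terms cannot produce.\<close>

lemma exceptional_patterns: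
  fixes P :: "nat \<Rightarrow> nat \<Rightarrow> bool"
  assumes p: "CARD('p::prime_card) \<ge> 5"
    and P: "map (\<lambda>(i, j). P i j) grid = [True, True, False, True, False, True, False, True, True]
      \<or> map (\<lambda>(i, j). P i j) grid = [True, True, False, False, True, True, True, False, True]"
  shows "\<exists>\<alpha> \<beta> \<alpha>' \<beta>'. \<forall>i<3. \<forall>j<3. decided (P i j)
    (\<alpha> i + \<beta> j + of_int ([[0,0,1], [0,0,0], [0,0,0]] ! i ! j))
    (\<alpha>' i + \<beta>' j + of_int (level2_matrix ! i ! j) :: 'p mod_ring)"
proof -
  let ?a = "\<lambda>i::nat. if i = 0 then 1 else 0 :: 'p mod_ring"
  \<comment> \<open>For the second pattern: adding 2 in the first two columns turns
    \<open>-1\<close> into 1 and 1 into 3, which is neither 0 nor 1 in the field.\<close>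
  let ?b = "\<lambda>j::nat. if j < 2 then 2 else 0 :: 'p mod_ring"
  have F: "(of_int u :: 'p mod_ring) \<noteq> 0" if "\<bar>u\<bar> < 5" "u \<noteq> 0" for u
    using small_not_dvd[of "int CARD('p)" u] p that by (simp add: of_int_mod_ring_eq_0_iff)
  have ne: "(2 :: 'p mod_ring) \<noteq> 0" "(2 :: 'p mod_ring) \<noteq> 1" "(3 :: 'p mod_ring) \<noteq> 0"
    "(3 :: 'p mod_ring) \<noteq> 1" "(- 1 :: 'p mod_ring) \<noteq> 1"
    using F[of 2] F[of 1] F[of 3] by (auto simp: neg_eq_iff_add_eq_0 eq_iff_diff_eq_0[of _ 1])
  from P show ?thesis
  proof
    assume "map (\<lambda>(i, j). P i j) grid = [True, True, False, True, False, True, False, True, True]"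
    then have "\<forall>i<3. \<forall>j<3. decided (P i j)
      (?a i + (\<lambda>_. 0) j + of_int ([[0,0,1], [0,0,0], [0,0,0]] ! i ! j))
      ((\<lambda>_. 0) i + (\<lambda>_. 0) j + of_int (level2_matrix ! i ! j))"
      using ne by (simp add: all_less_3 grid_def upt_rec decided_def level2_matrix_def flip: numeral_2_eq_2)
    then show ?thesis by (intro exI)
  next
    assume "map (\<lambda>(i, j). P i j) grid = [True, True, False, False, True, True, True, False, True]"
    then have "\<forall>i<3. \<forall>j<3. decided (P i j)
      (?a i + (\<lambda>_. 0) j + of_int ([[0,0,1], [0,0,0], [0,0,0]] ! i ! j))
      ((\<lambda>_. 0) i + ?b j + of_int (level2_matrix ! i ! j))"
      using ne by (simp add: all_less_3 grid_def upt_rec decided_def level2_matrix_def flip: numeral_2_eq_2)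
    then show ?thesis by (intro exI)
  qed
qed

text \<open>The interactions \<open>m\<close> may depend on the prime but not on the pattern, since
  \<open>x\<close> and \<open>y\<close> are built from them.\<close>

lemma exists_patterns:
  assumes p: "CARD('p::prime_card) > 2"
  shows "\<exists>m :: nat \<Rightarrow> nat \<Rightarrow> nat \<Rightarrow> 'p mod_ring. \<forall>P. \<exists>\<alpha> \<beta>. \<forall>i<3. \<forall>j<3.
    decided (P i j) (\<alpha> (1::nat) i + \<beta> (1::nat) j + m 1 i j) (\<alpha> 2 i + \<beta> 2 j + m 2 i j)"
proof -
  have two: "(2 :: 'p mod_ring) \<noteq> 0"
    by (rule two_mod_ring_nonzero[OF p])
  have "\<exists>m m'. \<forall>P. \<exists>\<alpha> \<beta> \<alpha>' \<beta>'. \<forall>i<3. \<forall>j<3. decided (P i j)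
    (\<alpha> i + \<beta> j + of_int (m ! i ! j)) (\<alpha>' i + \<beta>' j + of_int (m' ! i ! j) :: 'p mod_ring)"
  proof (cases "CARD('p) = 3")
    case True
    have R: "\<exists>\<alpha> \<beta> \<alpha>' \<beta>'. \<forall>i<3. \<forall>j<3. decided (P i j)
      (\<alpha> i + \<beta> j + of_int ([[1,0,0], [0,1,0], [0,0,1]] ! i ! j))
      (\<alpha>' i + \<beta>' j + of_int (level2_matrix ! i ! j) :: 'p mod_ring)" for P
      by (rule covers_realizes[OF represents_cls3[OF True] two covers_table3 acyclic_table3]) simp
    show ?thesis
      by (rule exI[of _ "[[1,0,0], [0,1,0], [0,0,1]]"], rule exI[of _ level2_matrix], rule allI, rule R)
  next
    case False
    have "CARD('p) \<noteq> 4"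
    proof
      assume "CARD('p) = 4"
      then have "prime (4 :: nat)" using prime_card[where 'a='p] by simp
      then show False using prime_product[of 2 2] by simp
    qed
    then have p5: "CARD('p) \<ge> 5" using p False by linarith
    have R: "\<exists>\<alpha> \<beta> \<alpha>' \<beta>'. \<forall>i<3. \<forall>j<3. decided (P i j)
      (\<alpha> i + \<beta> j + of_int ([[0,0,1], [0,0,0], [0,0,0]] ! i ! j))
      (\<alpha>' i + \<beta>' j + of_int (level2_matrix ! i ! j) :: 'p mod_ring)" for P
    proof (cases "map (\<lambda>(i, j). P i j) grid = [True, True, False, True, False, True, False, True, True]
      \<or> map (\<lambda>(i, j). P i j) grid = [True, True, False, False, True, True, True, False, True]")
      case True
      then show ?thesis by (rule exceptional_patterns[OF p5])
    next
      case False
      then have "covers cls5 [[0,0,1], [0,0,0], [0,0,0]] table5 (map (\<lambda>(i, j). P i j) grid)"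
        by (intro covers_table5) auto
      then show ?thesis
        by (rule covers_realizes[OF represents_cls5[OF p5] two _ acyclic_table5])
    qed
    show ?thesis
      by (rule exI[of _ "[[0,0,1], [0,0,0], [0,0,0]]"], rule exI[of _ level2_matrix], rule allI, rule R)
  qed
  then obtain m m' where mm: "\<forall>P. \<exists>\<alpha> \<beta> \<alpha>' \<beta>'. \<forall>i<3. \<forall>j<3. decided (P i j)
    (\<alpha> i + \<beta> j + of_int (m ! i ! j)) (\<alpha>' i + \<beta>' j + of_int (m' ! i ! j) :: 'p mod_ring)"
    by (elim exE)
  show ?thesis
  proof (intro exI[of _ "\<lambda>k i j. if k = 1 then of_int (m ! i ! j) else of_int (m' ! i ! j)"] allI)
    fix P :: "nat \<Rightarrow> nat \<Rightarrow> bool"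
    from mm[rule_format, of P] obtain \<alpha> \<beta> \<alpha>' \<beta>' where
      *: "\<forall>i<3. \<forall>j<3. decided (P i j)
        (\<alpha> i + \<beta> j + of_int (m ! i ! j)) (\<alpha>' i + \<beta>' j + of_int (m' ! i ! j) :: 'p mod_ring)"
      by (elim exE)
    show "\<exists>\<alpha> \<beta>. \<forall>i<3. \<forall>j<3. decided (P i j)
      (\<alpha> (1::nat) i + \<beta> (1::nat) j + (if (1::nat) = 1 then of_int (m ! i ! j) else of_int (m' ! i ! j)))
      (\<alpha> 2 i + \<beta> 2 j + (if (2::nat) = 1 then of_int (m ! i ! j) else of_int (m' ! i ! j)) :: 'p mod_ring)"
      by (rule exI[of _ "\<lambda>k. if k = (1::nat) then \<alpha> else \<alpha>'"],
          rule exI[of _ "\<lambda>k. if k = (1::nat) then \<beta> else \<beta>'"]) (use * in simp)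
  qed
qed

section \<open>From the first two forms to the set and its dimension\<close>

lemma QGS_iff_decided:
  fixes M :: "nat \<Rightarrow> 'p::prime_card mod_ring ^ 'n ^ 'n"
  assumes n: "CARD('n) \<ge> 2" and d: "decided b (quad_form (M 1) x) (quad_form (M 2) x)"
  shows "x \<in> QGS M \<longleftrightarrow> b"
proof (cases b)
  case True
  show ?thesis
  proof (cases "quad_form (M 1) x = 1")
    case True
    then have "x \<in> QGS M" using n unfolding QGS_def by (intro CollectI bexI[of _ 1]) auto
    then show ?thesis using \<open>b\<close> by simp
  next
    case False
    then have "quad_form (M 1) x = 0" "quad_form (M 2) x = 1"
      using d \<open>b\<close> by (auto simp: decided_def)
    moreover have "{1..<2 :: nat} = {1}" by auto
    ultimately have "x \<in> QGS M" using n unfolding QGS_def by (intro CollectI bexI[of _ 2]) auto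
    then show ?thesis using \<open>b\<close> by simp
  qed
next
  case False
  have "x \<notin> QGS M"
  proof
    assume "x \<in> QGS M"
    then obtain i where i: "i \<ge> 1" "\<And>j. 1 \<le> j \<Longrightarrow> j < i \<Longrightarrow> quad_form (M j) x = 0" "quad_form (M i) x = 1"
      by (auto simp: QGS_def)
    \<comment> \<open>An index above 2 would force both values to vanish, which
      \<open>decided\<close> excludes here; so later forms are never consulted.\<close>
    consider "i = 1" | "i = 2" | "i > 2" using i(1) by linarith
    then show False
      using i(2)[of 1] i(2)[of 2] i(3) d False by cases (simp_all add: decided_def)
  qed
  then show ?thesis using False by simp
qed

lemma full_rank_imp_injective:
  fixes A :: "'a::field ^ 'n ^ 'n"
  assumes "rank A = CARD('n)" "A *v x = 0"
  shows "x = 0"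
proof -
  have "vec.span (rows A) = UNIV"
    using assms(1)
    by (simp add: row_rank_def_gen vec.dim_eq_full[symmetric] card_cart_basis vec.dimension_def)
  then obtain B :: "'a ^ 'n ^ 'n" where "B ** A = mat 1"
    using matrix_left_invertible_span_rows_gen by blast
  then show ?thesis using assms(2) matrix_left_invertible_ker by blast
qed

lemma matrix_lincomb_mult:
  fixes M :: "nat \<Rightarrow> 'a::field ^ 'n ^ 'n"
  shows "matrix_lincomb c M *v x = (\<Sum>i=1..CARD('n). c i *s (M i *v x))"
  by (simp add: vec_eq_iff matrix_lincomb_def matrix_vector_mult_def sum_distrib_left sum_distrib_right mult.assoc)
     (subst sum.swap, simp)

theorem theorem1p8:
  fixes M :: "nat \<Rightarrow> 'p::prime_card mod_ring ^ 'n ^ 'n"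
  assumes "CARD('p) > 2"
    and "CARD('n) \<ge> 31"
    and "\<And>i. i \<in> {1..CARD('n)} \<Longrightarrow> transpose (M i) = M i"
    and "\<And>c. \<exists>i\<in>{1..CARD('n)}. c i \<noteq> 0 \<Longrightarrow> rank (matrix_lincomb c M) = CARD('n)"
  shows "vc2_dim (QGS M) \<ge> 3"
proof -
  have "nonsingular_pair M"
  proof
    show "transpose (M k) = M k" if "k \<in> {1, 2}" for k
      using that assms(2) by (intro assms(3)) auto
  next
    fix d :: "nat \<Rightarrow> 'p mod_ring" and x
    assume 0: "(\<Sum>k\<in>{1, 2}. d k *s (M k *v x)) = 0" and x: "x \<noteq> 0"
    \<comment> \<open>Padding with zeros makes the full rank hypothesis on all matrices apply to two
      of them.\<close>
    define c where "c k = (if k \<in> {1, 2} then d k else 0)" for k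
    have "matrix_lincomb c M *v x = (\<Sum>k\<in>{1, 2}. c k *s (M k *v x))"
      unfolding matrix_lincomb_mult using assms(2)
      by (intro sum.mono_neutral_right) (auto simp: c_def)
    also have "\<dots> = 0" using 0 by (simp add: c_def)
    finally have "rank (matrix_lincomb c M) \<noteq> CARD('n)"
      using x full_rank_imp_injective by blast
    then have "\<forall>i\<in>{1..CARD('n)}. c i = 0" using assms(4) by blast
    then show "\<forall>k\<in>{1, 2}. d k = 0" using assms(2) by (auto simp: c_def split: if_splits)
  next
    show "(2 :: 'p mod_ring) \<noteq> 0"
      by (rule two_mod_ring_nonzero[OF assms(1)])
  qed (use assms(2) in simp_all)
  then interpret nonsingular_pair M .
  from exists_patterns[OF assms(1)] obtain m :: "nat \<Rightarrow> nat \<Rightarrow> nat \<Rightarrow> 'p mod_ring" where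
    m: "\<forall>P. \<exists>\<alpha> \<beta>. \<forall>i<3. \<forall>j<3.
      decided (P i j) (\<alpha> (1::nat) i + \<beta> (1::nat) j + m 1 i j) (\<alpha> 2 i + \<beta> 2 j + m 2 i j)"
    by (elim exE)
  from grid_values[of m] obtain x y :: "nat \<Rightarrow> 'p mod_ring ^ 'n" where
    xy: "\<forall>\<alpha> \<beta>. \<exists>z. \<forall>k\<in>{1, 2}. \<forall>i<3. \<forall>j<3.
      quad_form (M k) (x i + y j + z) = \<alpha> k i + \<beta> k j + m k i j"
    by (elim exE)
  have key: "\<exists>z. \<forall>i<3. \<forall>j<3. x i + y j + z \<in> QGS M \<longleftrightarrow> P i j" for P
  proof -
    from m[rule_format, of P] obtain \<alpha> \<beta> :: "nat \<Rightarrow> nat \<Rightarrow> 'p mod_ring" where ab: "\<forall>i<3. \<forall>j<3.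
        decided (P i j) (\<alpha> 1 i + \<beta> 1 j + m 1 i j) (\<alpha> 2 i + \<beta> 2 j + m 2 i j)"
      by (elim exE)
    from xy[rule_format, of \<alpha> \<beta>] obtain z where z: "\<forall>k\<in>{1, 2}. \<forall>i<3. \<forall>j<3.
        quad_form (M k) (x i + y j + z) = \<alpha> k i + \<beta> k j + m k i j"
      by (elim exE)
    have R: "x i + y j + z \<in> QGS M \<longleftrightarrow> P i j" if "i < 3" "j < 3" for i j
      by (rule QGS_iff_decided) (use assms(2) ab z that in auto)
    show ?thesis
      by (rule exI[of _ z]) (intro allI impI R)
  qed
  \<comment> \<open>The grid is numbered from 0 and the dimension from 1, hence \<open>Suc\<close>
    here and \<open>i - 1\<close> below.\<close>
  have "\<forall>S. \<exists>z. \<forall>i<3. \<forall>j<3. x i + y j + z \<in> QGS M \<longleftrightarrow> (Suc i, Suc j) \<in> S"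
    by (rule allI) (rule key)
  from choice[OF this] obtain z where
    z: "\<forall>S. \<forall>i<3. \<forall>j<3. x i + y j + z S \<in> QGS M \<longleftrightarrow> (Suc i, Suc j) \<in> S"
    by (elim exE)
  have R: "x (i - 1) + y (j - 1) + z S \<in> QGS M \<longleftrightarrow> (i, j) \<in> S"
    if "i \<in> {1..3}" "j \<in> {1..3}" for S i j
    using z[rule_format, of "i - 1" "j - 1" S] that by auto
  have "vc2_dim_at_least (QGS M) 3"
    unfolding vc2_dim_at_least_def
    by (rule exI[of _ "\<lambda>i. x (i - 1)"], rule exI[of _ "\<lambda>j. y (j - 1)"], rule exI[of _ z])
       (intro allI ballI impI R)
  then show ?thesis by (simp add: le_vc2_dim_iff)
qed

end
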